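(* For an integer $n\ge 1$ let each edge $f$ of the complete bipartite graph $K_{n,n}$ be coloured with a colour $X_f$ chosen uniformly at random from $\{1,2,\ldots,r\}$, independently of the other edges, and let $R_n$ be the maximum size of a rainbow planar matching of the resulting randomly coloured graph. Let $r=\alpha n$ for some $\alpha>0$ (with $r$ an integer). There exists $0<\alpha_0<1$ such that for every $\alpha>\alpha_0$ there are constants $0<\beta_1\le\beta_2<1$ (strictly) and $\beta_3>0$, not depending on $n$, such that $$\mathbb{P}\left(\beta_1 r\le R_n\le \beta_2 r\right)\ge 1-e^{-\beta_3 n}\quad\text{and}\quad \beta_1 r\le \mathbb{E}R_n\le \beta_2 r.$$ Moreover, $\mathrm{var}(R_n)\le 2\,\mathbb{E}R_n$.
   Context: $K_{n,n}$ is the complete bipartite graph with bottom vertices $u_1,\ldots,u_n$ and top vertices $v_1,\ldots,v_n$; its edges are all pairs $(u_i,v_j)$, $1\le i,j\le n$. A matching of size $t$ is a set of $t$ pairwise vertex-disjoint edges. A matching $\{(u_{i_1},v_{j_1}),\ldots,(u_{i_t},v_{j_t})\}$ is planar if (after relabelling its edges) $i_1<i_2<\cdots<i_t$ and $j_1<j_2<\cdots<j_t$. A planar matching $\{h_1,\ldots,h_t\}$ is rainbow if $X_{h_i}\ne X_{h_j}$ whenever $h_i\ne h_j$, i.e. all its edges have distinct colours.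
   Formalization: The case n = r = 1 (so α = 1) is excluded from the probability and expectation bounds, since there R_1 = 1 = r surely and no β_2 < 1 can satisfy R_1 ≤ β_2 r; the variance bound still covers this case. *)

theory Defs
  imports "HOL-Probability.Probability"
begin

(* The pair (i, j) stands for the edge joining bottom vertex u_i and top vertex v_j. *)
definition Knn_edges :: "nat \<Rightarrow> (nat \<times> nat) set" where
  "Knn_edges n = {1..n} \<times> {1..n}"

(* A bottom vertex is never a top vertex, so two edges are vertex-disjoint iff
   they differ in both coordinates. *)
definition matching :: "nat \<Rightarrow> (nat \<times> nat) set \<Rightarrow> bool" where
  "matching n M \<longleftrightarrow> M \<subseteq> Knn_edges n \<and>
     (\<forall>e\<in>M. \<forall>f\<in>M. e \<noteq> f \<longrightarrow> fst e \<noteq> fst f \<and> snd e \<noteq> snd f)"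

(* The list es is the relabelling of the edges of M that makes both end points increase. *)
definition planar_matching :: "nat \<Rightarrow> (nat \<times> nat) set \<Rightarrow> bool" where
  "planar_matching n M \<longleftrightarrow> matching n M \<and>
     (\<exists>es. set es = M \<and> sorted_wrt (\<lambda>e f. fst e < fst f \<and> snd e < snd f) es)"

definition rainbow_planar_matching ::
    "nat \<Rightarrow> (nat \<times> nat \<Rightarrow> nat) \<Rightarrow> (nat \<times> nat) set \<Rightarrow> bool" where
  "rainbow_planar_matching n X M \<longleftrightarrow> planar_matching n M \<and>
     (\<forall>e\<in>M. \<forall>f\<in>M. e \<noteq> f \<longrightarrow> X e \<noteq> X f)"

definition max_rainbow :: "nat \<Rightarrow> (nat \<times> nat \<Rightarrow> nat) \<Rightarrow> nat" where
  "max_rainbow n X = Max (card ` {M. rainbow_planar_matching n X M})"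

(* The value 0 outside the edge set is a dummy; it is not a colour. *)
definition colouring_pmf :: "nat \<Rightarrow> nat \<Rightarrow> (nat \<times> nat \<Rightarrow> nat) pmf" where
  "colouring_pmf n r = Pi_pmf (Knn_edges n) 0 (\<lambda>_. pmf_of_set {1..r})"

(* On a single edge the maximum is always 1. Hence with one vertex on each side and r = 1
   colour one has R_1 = r almost surely, and no bound R_1 \<le> b * r with b < 1 can hold. *)
lemma max_rainbow_1: "max_rainbow 1 X = 1"
proof -
  have sub: "M = {} \<or> M = {(1, 1)}" if "rainbow_planar_matching 1 X M" for M
  proof -
    have "M \<subseteq> {(1, 1)}"
      using that by (auto simp: rainbow_planar_matching_def planar_matching_def matching_def
          Knn_edges_def)
    thus ?thesis by blast
  qed
  have "rainbow_planar_matching 1 X {}"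
    by (auto simp: rainbow_planar_matching_def planar_matching_def matching_def)
  moreover have "rainbow_planar_matching 1 X {(1, 1)}"
    by (auto simp: rainbow_planar_matching_def planar_matching_def matching_def Knn_edges_def
        intro: exI[of _ "[(1, 1)]"])
  ultimately have "{M. rainbow_planar_matching 1 X M} = {{}, {(1, 1)}}"
    using sub by blast
  thus ?thesis by (simp add: max_rainbow_def)
qed

end

theory Submission
  imports Defs
begin

text \<open>Lower tail: already the number of distinct colours on the diagonal edges \<open>(i, i)\<close> is linear
  in \<open>r\<close> outside an exponentially small event. Upper tail: for \<open>\<alpha> > 1\<close> the bound \<open>R\<^sub>n \<le> n = r / \<alpha>\<close>
  is enough; for \<open>\<alpha>\<close> just below or equal to \<open>1\<close> a first moment bound works for \<open>n \<ge> 20\<close>, and the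
  finitely many smaller \<open>n\<close> are absorbed into the constants because a monochromatic colouring
  (\<open>R\<^sub>n = 1 < r\<close>) has positive probability. Variance: \<open>R\<^sub>n\<close> is a self-bounding function of the
  independent edge colours, so Efron--Stein gives even \<open>var R\<^sub>n \<le> E R\<^sub>n\<close>.\<close>

section \<open>Rainbow planar matchings\<close>

lemma finite_Knn_edges [simp]: "finite (Knn_edges n)"
  by (simp add: Knn_edges_def)

lemma card_Knn_edges: "card (Knn_edges n) = n\<^sup>2"
  by (simp add: Knn_edges_def power2_eq_square)

lemma planar_matching_subset_edges: "planar_matching n M \<Longrightarrow> M \<subseteq> Knn_edges n"
  by (simp add: planar_matching_def matching_def)

lemma finite_planar_matchings: "finite {M. planar_matching n M}"
  by (rule finite_subset[of _ "Pow (Knn_edges n)"]) (auto dest: planar_matching_subset_edges)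

lemma finite_rainbow_planar_matchings: "finite {M. rainbow_planar_matching n X M}"
  by (rule finite_subset[OF _ finite_planar_matchings[of n]])
     (auto simp: rainbow_planar_matching_def)

lemma finite_planar_matching: "planar_matching n M \<Longrightarrow> finite M"
  by (meson planar_matching_subset_edges finite_Knn_edges finite_subset)

lemma rainbow_planar_matching_iff:
  "rainbow_planar_matching n X M \<longleftrightarrow> planar_matching n M \<and> inj_on X M"
  by (auto simp: rainbow_planar_matching_def inj_on_def)

lemma planar_matching_empty [simp]: "planar_matching n {}"
  by (simp add: planar_matching_def matching_def)

lemma planar_matching_subset:
  assumes "planar_matching n M" "M' \<subseteq> M"
  shows "planar_matching n M'"
proof -
  obtain es where es: "set es = M" "sorted_wrt (\<lambda>e f. fst e < fst f \<and> snd e < snd f) es"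
    using assms by (auto simp: planar_matching_def)
  have "set (filter (\<lambda>e. e \<in> M') es) = M'"
    using es(1) assms(2) by auto
  moreover have "sorted_wrt (\<lambda>e f. fst e < fst f \<and> snd e < snd f) (filter (\<lambda>e. e \<in> M') es)"
    using es(2) by (rule sorted_wrt_filter)
  moreover have "matching n M'"
    using assms unfolding planar_matching_def matching_def by (meson subsetD subset_trans)
  ultimately show ?thesis
    unfolding planar_matching_def by blast
qed

lemma planar_matching_diagonal:
  assumes "I \<subseteq> {1..n}"
  shows "planar_matching n ((\<lambda>i. (i, i)) ` I)"
proof -
  have fin: "finite I" using assms finite_subset by blast
  let ?es = "map (\<lambda>i. (i, i)) (sorted_list_of_set I)"
  have "set ?es = (\<lambda>i. (i, i)) ` I" using fin by simp
  moreover have "sorted_wrt (\<lambda>e f. fst e < fst f \<and> snd e < snd f) ?es"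
    by (simp add: sorted_wrt_map)
  moreover have "matching n ((\<lambda>i. (i, i)) ` I)"
    using assms by (auto simp: matching_def Knn_edges_def)
  ultimately show ?thesis
    unfolding planar_matching_def by blast
qed

text \<open>Monotonicity in both coordinates forces the k-th smallest bottom vertex to be joined to
  the k-th smallest top vertex. A planar matching is thus determined by its two endpoint sets, which
  reduces counting matchings to counting pairs of subsets.\<close>

lemma planar_matching_eq_zip:
  assumes "planar_matching n M"
  shows "M = set (zip (sorted_list_of_set (fst ` M)) (sorted_list_of_set (snd ` M)))"
    and "card (fst ` M) = card M" "card (snd ` M) = card M"
proof -
  obtain es where es: "set es = M" "sorted_wrt (\<lambda>e f. fst e < fst f \<and> snd e < snd f) es"
    using assms by (auto simp: planar_matching_def)
  have "sorted_wrt (<) (map fst es)" "sorted_wrt (<) (map snd es)"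
    unfolding sorted_wrt_map by (rule sorted_wrt_mono_rel[OF _ es(2)]; simp)+
  moreover have fin: "finite M" using assms by (rule finite_planar_matching)
  ultimately have "map fst es = sorted_list_of_set (fst ` M)"
      "map snd es = sorted_list_of_set (snd ` M)"
    using es(1) by (auto intro!: strict_sorted_equal)
  then show "M = set (zip (sorted_list_of_set (fst ` M)) (sorted_list_of_set (snd ` M)))"
    using es(1) by (metis zip_map_fst_snd)
  have "matching n M" using assms by (simp add: planar_matching_def)
  then show "card (fst ` M) = card M" "card (snd ` M) = card M"
    by (intro card_image; force simp: matching_def inj_on_def)+
qed

lemma card_planar_matching_le:
  assumes "planar_matching n M"
  shows "card M \<le> n"
proof -
  have "fst ` M \<subseteq> {1..n}"
    using planar_matching_subset_edges[OF assms] by (auto simp: Knn_edges_def)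
  then have "card (fst ` M) \<le> card {1..n}" by (intro card_mono) auto
  then show ?thesis using planar_matching_eq_zip(2)[OF assms] by simp
qed

lemma card_planar_matchings_le:
  "card {M. planar_matching n M \<and> card M = t} \<le> (n choose t)\<^sup>2"
proof -
  let ?S = "{I. I \<subseteq> {1..n} \<and> card I = t}"
  let ?P = "{M. planar_matching n M \<and> card M = t}"
  have "inj_on (\<lambda>M. (fst ` M, snd ` M)) ?P"
  proof (intro inj_onI)
    fix M M' assume "M \<in> ?P" "M' \<in> ?P" "(fst ` M, snd ` M) = (fst ` M', snd ` M')"
    then have M: "planar_matching n M" "planar_matching n M'"
        and eq: "fst ` M = fst ` M'" "snd ` M = snd ` M'"
      by auto
    show "M = M'"
      by (subst planar_matching_eq_zip(1)[OF M(1)], subst planar_matching_eq_zip(1)[OF M(2)])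
         (simp only: eq)
  qed
  moreover have "(\<lambda>M. (fst ` M, snd ` M)) ` ?P \<subseteq> ?S \<times> ?S"
  proof clarsimp
    fix M assume M: "planar_matching n M"
    show "fst ` M \<subseteq> {Suc 0..n} \<and> card (fst ` M) = card M \<and>
        snd ` M \<subseteq> {Suc 0..n} \<and> card (snd ` M) = card M"
      using planar_matching_eq_zip(2,3)[OF M] planar_matching_subset_edges[OF M]
      by (auto simp: Knn_edges_def)
  qed
  ultimately have "card ?P \<le> card (?S \<times> ?S)"
    by (rule card_inj_on_le) simp
  also have "\<dots> = (n choose t)\<^sup>2"
    by (simp add: card_cartesian_product n_subsets power2_eq_square)
  finally show ?thesis .
qed

section \<open>Elementary bounds on the maximum rainbow size\<close>

lemma max_rainbow_ge:
  assumes "planar_matching n M" "inj_on X M"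
  shows "card M \<le> max_rainbow n X"
  unfolding max_rainbow_def using assms
  by (intro Max_ge finite_imageI finite_rainbow_planar_matchings imageI)
     (simp add: rainbow_planar_matching_iff)

lemma max_rainbow_attained:
  obtains M where "planar_matching n M" "inj_on X M" "card M = max_rainbow n X"
proof -
  have "{} \<in> {M. rainbow_planar_matching n X M}"
    by (simp add: rainbow_planar_matching_iff)
  then have "max_rainbow n X \<in> card ` {M. rainbow_planar_matching n X M}"
    unfolding max_rainbow_def using finite_rainbow_planar_matchings[of n X]
    by (intro Max_in) auto
  then show ?thesis using that by (auto simp: rainbow_planar_matching_iff)
qed

lemma max_rainbow_le: "max_rainbow n X \<le> n"
  using card_planar_matching_le by (metis max_rainbow_attained)

lemma max_rainbow_le_colours:
  assumes "\<And>e. e \<in> Knn_edges n \<Longrightarrow> X e \<in> {1..r}"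
  shows "max_rainbow n X \<le> r"
proof -
  obtain M where M: "planar_matching n M" "inj_on X M" "card M = max_rainbow n X"
    by (rule max_rainbow_attained)
  have "card (X ` M) \<le> card {1..r}"
    using assms planar_matching_subset_edges[OF M(1)] by (intro card_mono) auto
  then show ?thesis using M(2,3) by (simp add: card_image)
qed

text \<open>Every subset of the diagonal is a planar matching, so keeping one diagonal edge per
  colour gives a rainbow one.\<close>

lemma max_rainbow_ge_diagonal: "card ((\<lambda>i. X (i, i)) ` {1..n}) \<le> max_rainbow n X"
proof -
  obtain I where I: "I \<subseteq> {1..n}" "(\<lambda>i. X (i, i)) ` {1..n} = (\<lambda>i. X (i, i)) ` I"
      "inj_on (\<lambda>i. X (i, i)) I"
    using subset_image_inj[of "(\<lambda>i. X (i, i)) ` {1..n}" "\<lambda>i. X (i, i)" "{1..n}"] by blast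
  have "inj_on X ((\<lambda>i. (i, i)) ` I)"
    using I(3) by (auto simp: inj_on_def)
  with I(1) have "card ((\<lambda>i. (i, i)) ` I) \<le> max_rainbow n X"
    by (intro max_rainbow_ge planar_matching_diagonal)
  moreover have "card ((\<lambda>i. (i, i)) ` I) = card I"
    by (intro card_image inj_onI) auto
  ultimately show ?thesis using I(2,3) by (simp add: card_image)
qed

lemma max_rainbow_pos: "n \<ge> 1 \<Longrightarrow> 1 \<le> max_rainbow n X"
proof -
  assume "n \<ge> 1"
  then have "card ((\<lambda>i. X (i, i)) ` {1..n}) > 0" by (simp add: card_gt_0_iff)
  then show ?thesis using max_rainbow_ge_diagonal[of X n] by linarith
qed

lemma max_rainbow_monochromatic:
  assumes "\<And>e. e \<in> Knn_edges n \<Longrightarrow> X e = c"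
  shows "max_rainbow n X \<le> 1"
proof -
  obtain M where M: "planar_matching n M" "inj_on X M" "card M = max_rainbow n X"
    by (rule max_rainbow_attained)
  have "X ` M \<subseteq> {c}"
    using assms planar_matching_subset_edges[OF M(1)] by auto
  then have "card (X ` M) \<le> card {c}" by (intro card_mono) auto
  then show ?thesis using M(2,3) by (simp add: card_image)
qed

section \<open>Expectations over finite product distributions\<close>

text \<open>Fubini with the new coordinate integrated innermost; finite supports take care of
  integrability.\<close>

lemma expectation_Pi_pmf_insert:
  fixes f :: "('a \<Rightarrow> 'b) \<Rightarrow> real"
  assumes "finite A" "x \<notin> A" "\<And>z. z \<in> insert x A \<Longrightarrow> finite (set_pmf (p z))"
  shows "measure_pmf.expectation (Pi_pmf (insert x A) d p) f =
    measure_pmf.expectation (Pi_pmf A d p)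
      (\<lambda>h. measure_pmf.expectation (p x) (\<lambda>y. f (h(x := y))))"
proof -
  have fin: "finite (set_pmf (Pi_pmf A d p))"
    using assms by (auto simp: set_Pi_pmf)
  have "Pi_pmf (insert x A) d p = Pi_pmf A d p \<bind> (\<lambda>h. map_pmf (\<lambda>y. h(x := y)) (p x))"
    using assms by (simp add: Pi_pmf_insert' map_pmf_def bind_commute_pmf[of "p x"])
  then have "measure_pmf.expectation (Pi_pmf (insert x A) d p) f =
      (\<Sum>h\<in>set_pmf (Pi_pmf A d p). pmf (Pi_pmf A d p) h *\<^sub>R
        measure_pmf.expectation (map_pmf (\<lambda>y. h(x := y)) (p x)) f)"
    using fin assms(3) by (simp add: pmf_expectation_bind[OF fin])
  also have "\<dots> = measure_pmf.expectation (Pi_pmf A d p)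
      (\<lambda>h. measure_pmf.expectation (map_pmf (\<lambda>y. h(x := y)) (p x)) f)"
    using fin by (subst integral_measure_pmf[of "set_pmf (Pi_pmf A d p)"]) auto
  finally show ?thesis by simp
qed

text \<open>Bias-variance decomposition. It serves three ends below: splitting off the variance of a
  conditional mean, minimality of the mean among constants, and Jensen's inequality for squares
  (\<open>c = 0\<close>).\<close>

lemma expectation_square_diff_pmf:
  fixes f :: "'a \<Rightarrow> real"
  assumes "finite (set_pmf p)"
  shows "measure_pmf.expectation p (\<lambda>x. (f x - c)\<^sup>2) =
    measure_pmf.variance p f + (measure_pmf.expectation p f - c)\<^sup>2"
proof -
  have [simp]: "integrable p u" for u :: "'a \<Rightarrow> real"
    using assms by (rule integrable_measure_pmf_finite)
  define m where "m = measure_pmf.expectation p f"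
  have "measure_pmf.expectation p (\<lambda>x. (f x - c)\<^sup>2) =
      measure_pmf.expectation p (\<lambda>x. (f x - m)\<^sup>2 + 2 * (m - c) * f x + (c\<^sup>2 - m\<^sup>2))"
    by (intro arg_cong[where f = "measure_pmf.expectation p"] ext)
       (simp add: power2_eq_square algebra_simps)
  also have "\<dots> = measure_pmf.variance p f + (m - c)\<^sup>2"
    by (simp flip: m_def) (simp add: power2_eq_square algebra_simps)
  finally show ?thesis by (simp add: m_def)
qed

text \<open>The Efron--Stein inequality, with the conditional mean given all coordinates but the
  \<open>x\<close>-th replaced by an arbitrary function \<open>g x\<close> of these coordinates.\<close>

lemma variance_Pi_pmf_le:
  fixes f :: "('a \<Rightarrow> 'b) \<Rightarrow> real"
  assumes "finite A" "\<And>x. x \<in> A \<Longrightarrow> finite (set_pmf (p x))"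
    and "\<And>x h y. x \<in> A \<Longrightarrow> g x (h(x := y)) = g x h"
  shows "measure_pmf.variance (Pi_pmf A d p) f \<le>
    (\<Sum>x\<in>A. measure_pmf.expectation (Pi_pmf A d p) (\<lambda>h. (f h - g x h)\<^sup>2))"
  using assms
proof (induction A arbitrary: f g rule: finite_induct)
  case empty
  then show ?case by simp
next
  case (insert x A)
  let ?E = "measure_pmf.expectation (Pi_pmf A d p)"
  let ?Ex = "measure_pmf.expectation (p x)"
  let ?E' = "measure_pmf.expectation (Pi_pmf (insert x A) d p)"
  have finx: "finite (set_pmf (p x))" using insert.prems by simp
  have finA: "finite (set_pmf (Pi_pmf A d p))"
    using insert by (auto simp: set_Pi_pmf)
  have intx [simp]: "integrable (p x) u" for u :: "'b \<Rightarrow> real"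
    using finx by (rule integrable_measure_pmf_finite)
  have intA [simp]: "integrable (Pi_pmf A d p) u" for u :: "('a \<Rightarrow> 'b) \<Rightarrow> real"
    using finA by (rule integrable_measure_pmf_finite)
  have E': "?E' u = ?E (\<lambda>h. ?Ex (\<lambda>y. u (h(x := y))))" for u :: "('a \<Rightarrow> 'b) \<Rightarrow> real"
    using insert by (intro expectation_Pi_pmf_insert) auto
  \<comment> \<open>Averaging over coordinate \<open>x\<close> turns \<open>f\<close> and each
    \<open>g z\<close> into functions of the remaining coordinates, to which the induction
    hypothesis applies.\<close>
  define m where "m = (\<lambda>h. ?Ex (\<lambda>y. f (h(x := y))))"
  define G where "G = (\<lambda>z h. ?Ex (\<lambda>y. g z (h(x := y))))"
  define \<mu> where "\<mu> = ?E' f"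
  have \<mu>: "\<mu> = ?E m" unfolding \<mu>_def m_def by (rule E')
  have "measure_pmf.variance (Pi_pmf (insert x A) d p) f =
      ?E (\<lambda>h. ?Ex (\<lambda>y. (f (h(x := y)) - \<mu>)\<^sup>2))"
    unfolding \<mu>_def by (rule E')
  \<comment> \<open>For fixed \<open>h\<close> the value \<open>g x (h(x := y))\<close> does not
    depend on \<open>y\<close>, so the mean square distance of \<open>f\<close> to it is at least
    the variance in coordinate \<open>x\<close>.\<close>
  also have "\<dots> \<le> ?E (\<lambda>h. ?Ex (\<lambda>y. (f (h(x := y)) - g x (h(x := y)))\<^sup>2) + (m h - \<mu>)\<^sup>2)"
  proof (intro integral_mono intA)
    fix h
    show "?Ex (\<lambda>y. (f (h(x := y)) - \<mu>)\<^sup>2) \<le>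
        ?Ex (\<lambda>y. (f (h(x := y)) - g x (h(x := y)))\<^sup>2) + (m h - \<mu>)\<^sup>2"
      using expectation_square_diff_pmf[OF finx, of "\<lambda>y. f (h(x := y))" \<mu>]
        expectation_square_diff_pmf[OF finx, of "\<lambda>y. f (h(x := y))" "g x h"]
      by (simp add: m_def insert.prems(2))
  qed
  also have "\<dots> = ?E' (\<lambda>h. (f h - g x h)\<^sup>2) + measure_pmf.variance (Pi_pmf A d p) m"
    by (simp add: E' \<mu>)
  also have "measure_pmf.variance (Pi_pmf A d p) m \<le> (\<Sum>z\<in>A. ?E (\<lambda>h. (m h - G z h)\<^sup>2))"
  proof (rule insert.IH)
    fix z h w assume "z \<in> A"
    then have "(h(z := w))(x := y) = (h(x := y))(z := w)" for y :: 'b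
      using insert.hyps by (intro fun_upd_twist) auto
    then have "g z ((h(z := w))(x := y)) = g z (h(x := y))" for y
      using insert.prems(2)[of z "h(x := y)" w] \<open>z \<in> A\<close> by (metis insertI2)
    then show "G z (h(z := w)) = G z h"
      unfolding G_def by presburger
  qed (use insert.prems in auto)
  also have "\<dots> \<le> (\<Sum>z\<in>A. ?E' (\<lambda>h. (f h - g z h)\<^sup>2))"
  proof (intro sum_mono)
    fix z
    show "?E (\<lambda>h. (m h - G z h)\<^sup>2) \<le> ?E' (\<lambda>h. (f h - g z h)\<^sup>2)"
      unfolding E'
    proof (intro integral_mono intA)
      fix h
      \<comment> \<open>Jensen: the square of a mean is at most the mean of the square, since a
        variance is nonnegative.\<close>
      have "m h - G z h = ?Ex (\<lambda>y. f (h(x := y)) - g z (h(x := y)))"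
        by (simp add: m_def G_def)
      then show "(m h - G z h)\<^sup>2 \<le> ?Ex (\<lambda>y. (f (h(x := y)) - g z (h(x := y)))\<^sup>2)"
        using expectation_square_diff_pmf[OF finx, of "\<lambda>y. f (h(x := y)) - g z (h(x := y))" 0]
          measure_pmf.variance_positive[of "p x" "\<lambda>y. f (h(x := y)) - g z (h(x := y))"]
        by simp
    qed
  qed
  finally show ?case using insert.hyps by simp
qed

text \<open>Birthday product: colours are revealed one at a time, each avoiding those already used.
  If \<open>card M > r\<close>, the factor with \<open>i = r\<close> vanishes, as it should.\<close>

lemma prob_inj_on_Pi_pmf:
  assumes "finite A" "M \<subseteq> A" "r \<ge> 1"
  shows "measure_pmf.prob (Pi_pmf A d (\<lambda>_. pmf_of_set {1..r})) {X. inj_on X M} =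
    (\<Prod>i<card M. 1 - real i / real r)"
proof -
  have set1: "set_pmf (pmf_of_set {1..r}) = {1..r}" using assms(3) by (intro set_pmf_of_set) auto
  have "measure_pmf.prob (Pi_pmf M d (\<lambda>_. pmf_of_set {1..r})) {X. inj_on X M} =
    (\<Prod>i<card M. 1 - real i / real r)"
    using finite_subset[OF assms(2,1)]
  proof (induction M rule: finite_induct)
    case empty
    then show ?case by simp
  next
    case (insert x M)
    let ?P = "Pi_pmf M d (\<lambda>_. pmf_of_set {1..r})"
    let ?P' = "Pi_pmf (insert x M) d (\<lambda>_. pmf_of_set {1..r})"
    have "measure_pmf.prob ?P' {X. inj_on X (insert x M)} =
        measure_pmf.expectation ?P' (indicator {X. inj_on X (insert x M)})"
      by simp
    also have "\<dots> = measure_pmf.expectation ?P (\<lambda>X. measure_pmf.expectation (pmf_of_set {1..r})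
        (\<lambda>y. indicator {X. inj_on X (insert x M)} (X(x := y))))"
      using insert set1 by (intro expectation_Pi_pmf_insert) auto
    also have "\<dots> = measure_pmf.expectation ?P
        (\<lambda>X. (1 - real (card M) / real r) * indicator {X. inj_on X M} X)"
    proof (intro integral_cong_AE AE_pmfI)
      fix X assume "X \<in> set_pmf ?P"
      then have X: "X ` M \<subseteq> {1..r}"
        using insert.hyps set1 by (auto simp: set_Pi_pmf PiE_dflt_def)
      have upd: "inj_on (X(x := y)) (insert x M) \<longleftrightarrow> inj_on X M \<and> y \<notin> X ` M" for y
        using insert.hyps by (auto simp: inj_on_def)
      have "measure_pmf.expectation (pmf_of_set {1..r})
          (\<lambda>y. indicator {X. inj_on X (insert x M)} (X(x := y))) =
        measure_pmf.expectation (pmf_of_set {1..r})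
          (\<lambda>y. indicator {X. inj_on X M} X * indicator (- (X ` M)) y :: real)"
        by (intro arg_cong[where f = "measure_pmf.expectation _"] ext)
           (simp only: indicator_def mem_Collect_eq upd, auto)
      also have "\<dots> = indicator {X. inj_on X M} X *
          measure_pmf.prob (pmf_of_set {1..r}) (- (X ` M))"
        by simp
      also have "measure_pmf.prob (pmf_of_set {1..r}) (- (X ` M)) =
          1 - real (card (X ` M)) / real r"
      proof -
        have "measure_pmf.prob (pmf_of_set {1..r}) (X ` M) = real (card (X ` M)) / real r"
          using assms(3) X by (subst measure_pmf_of_set) (auto simp: Int_absorb1)
        then show ?thesis
          using measure_pmf.prob_compl[of "X ` M" "pmf_of_set {1..r}"]
          by (simp add: Compl_eq_Diff_UNIV)
      qed
      finally have eq: "measure_pmf.expectation (pmf_of_set {1..r})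
          (\<lambda>y. indicator {X. inj_on X (insert x M)} (X(x := y))) =
        indicator {X. inj_on X M} X * (1 - real (card (X ` M)) / real r)" .
      show "measure_pmf.expectation (pmf_of_set {1..r})
          (\<lambda>y. indicator {X. inj_on X (insert x M)} (X(x := y))) =
        (1 - real (card M) / real r) * indicator {X. inj_on X M} X"
        unfolding eq by (auto simp: indicator_def card_image)
    qed auto
    finally show ?case using insert by simp
  qed
  \<comment> \<open>The product over \<open>M\<close> is a marginal of the product over
    \<open>A\<close>; resetting values outside \<open>M\<close> to \<open>d\<close> does not affect
    injectivity on \<open>M\<close>.\<close>
  moreover have "(\<lambda>f x. if x \<in> M then f x else d) -` {X. inj_on X M} = {X. inj_on X M}"
    by (auto simp: inj_on_def)
  ultimately show ?thesis
    using assms(1,2) by (simp add: Pi_pmf_subset[of A M])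
qed

section \<open>Random colourings\<close>

lemma set_colouring_pmf:
  assumes "r \<ge> 1"
  shows "set_pmf (colouring_pmf n r) = PiE_dflt (Knn_edges n) 0 (\<lambda>_. {1..r})"
proof -
  have "set_pmf (pmf_of_set {1..r}) = {1..r}" using assms by (intro set_pmf_of_set) auto
  then show ?thesis by (simp add: colouring_pmf_def set_Pi_pmf o_def)
qed

lemma integrable_colouring_pmf [simp]:
  fixes f :: "_ \<Rightarrow> real"
  assumes "r \<ge> 1"
  shows "integrable (colouring_pmf n r) f"
  using assms by (intro integrable_measure_pmf_finite) (auto simp: set_colouring_pmf)

lemma max_rainbow_le_colouring_pmf:
  assumes "r \<ge> 1" "X \<in> set_pmf (colouring_pmf n r)"
  shows "max_rainbow n X \<le> r"
  using assms by (intro max_rainbow_le_colours) (auto simp: set_colouring_pmf PiE_dflt_def)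

text \<open>Deleting an edge lowers the maximum by at most one, and lowers it at all only if the edge
  lies in every maximum rainbow matching. So \<open>max_rainbow\<close> is self-bounding, and Efron--Stein
  bounds its variance by its mean.\<close>

lemma variance_max_rainbow_le:
  assumes "r \<ge> 1"
  shows "measure_pmf.variance (colouring_pmf n r) (\<lambda>X. real (max_rainbow n X)) \<le>
    measure_pmf.expectation (colouring_pmf n r) (\<lambda>X. real (max_rainbow n X))"
proof -
  let ?E = "measure_pmf.expectation (colouring_pmf n r)"
  \<comment> \<open>\<open>g e X\<close> is the maximum after deleting the edge \<open>e\<close>. It
    ignores the colour of \<open>e\<close>, as the Efron--Stein bound requires.\<close>
  define S where "S = (\<lambda>e (X :: nat \<times> nat \<Rightarrow> nat). {M. planar_matching n M \<and> inj_on X M \<and> e \<notin> M})"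
  define g where "g = (\<lambda>e X. Max (card ` S e X))"
  have finS: "finite (S e X)" for e X
    unfolding S_def by (rule finite_subset[OF _ finite_planar_matchings[of n]]) auto
  have g_ge: "card M \<le> g e X" if "M \<in> S e X" for e X M
    unfolding g_def using that finS by (intro Max_ge) auto
  have g_le: "g e X \<le> max_rainbow n X" for e X
  proof -
    have "{} \<in> S e X" by (simp add: S_def)
    then show ?thesis
      unfolding g_def using finS[of e X] by (intro Max.boundedI) (auto simp: S_def intro: max_rainbow_ge)
  qed
  have g_upd: "g e (X(e := c)) = g e X" for e c and X :: "nat \<times> nat \<Rightarrow> nat"
  proof -
    have "inj_on (X(e := c)) M \<longleftrightarrow> inj_on X M" if "e \<notin> M" for M :: "(nat \<times> nat) set"
      using that by (intro inj_on_cong) auto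
    then have "S e (X(e := c)) = S e X" unfolding S_def by blast
    then show ?thesis by (simp add: g_def)
  qed
  have self_bounding: "(\<Sum>e\<in>Knn_edges n. (real (max_rainbow n X) - real (g e X))\<^sup>2)
      \<le> real (max_rainbow n X)" for X
  proof -
    obtain M where M: "planar_matching n M" "inj_on X M" "card M = max_rainbow n X"
      by (rule max_rainbow_attained)
    have "(real (max_rainbow n X) - real (g e X))\<^sup>2 \<le> (if e \<in> M then 1 else 0)" for e
    proof (cases "e \<in> M")
      case True
      have "M - {e} \<in> S e X"
        using M by (auto simp: S_def intro: planar_matching_subset inj_on_subset)
      then have "max_rainbow n X - 1 \<le> g e X"
        using g_ge[of "M - {e}" e X] True M(3) by simp
      then have "\<bar>real (max_rainbow n X) - real (g e X)\<bar> \<le> 1"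
        using g_le[of e X] by linarith
      then show ?thesis using True by (simp add: abs_square_le_1)
    next
      case False
      then have "M \<in> S e X" using M by (auto simp: S_def)
      then have "g e X = max_rainbow n X" using g_ge[of M e X] g_le[of e X] M(3) by simp
      then show ?thesis using False by simp
    qed
    then have "(\<Sum>e\<in>Knn_edges n. (real (max_rainbow n X) - real (g e X))\<^sup>2) \<le>
        (\<Sum>e\<in>Knn_edges n. if e \<in> M then 1 else 0)"
      by (intro sum_mono)
    also have "\<dots> = real (card (Knn_edges n \<inter> M))"
      by (simp add: sum.If_cases)
    also have "Knn_edges n \<inter> M = M"
      using planar_matching_subset_edges[OF M(1)] by blast
    finally show ?thesis using M(3) by simp
  qed
  have "measure_pmf.variance (colouring_pmf n r) (\<lambda>X. real (max_rainbow n X)) \<le>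
      (\<Sum>e\<in>Knn_edges n. ?E (\<lambda>X. (real (max_rainbow n X) - real (g e X))\<^sup>2))"
    unfolding colouring_pmf_def
    by (rule variance_Pi_pmf_le) (use assms in \<open>auto simp: g_upd set_pmf_of_set\<close>)
  also have "\<dots> = ?E (\<lambda>X. \<Sum>e\<in>Knn_edges n. (real (max_rainbow n X) - real (g e X))\<^sup>2)"
    using assms by simp
  also have "\<dots> \<le> ?E (\<lambda>X. real (max_rainbow n X))"
    using assms by (intro integral_mono self_bounding integrable_colouring_pmf)
  finally show ?thesis .
qed

text \<open>The number of colours on the diagonal is a lower bound for \<open>max_rainbow\<close>; if it is less
  than \<open>b * r\<close>, then the diagonal is coloured from one of at most \<open>2 ^ r\<close> palettes of that size.\<close>

lemma prob_max_rainbow_less: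
  assumes "r \<ge> 1" "b \<ge> 0"
  shows "measure_pmf.prob (colouring_pmf n r) {X. real (max_rainbow n X) < b * real r} \<le>
    2 ^ r * b ^ n"
proof -
  let ?p = "colouring_pmf n r"
  define F where "F = {S. S \<subseteq> {1..r} \<and> real (card S) < b * real r}"
  \<comment> \<open>Only diagonal edges are confined to the palette \<open>S\<close>. The event is
    then a product over all edges, with factor 1 off the diagonal.\<close>
  define B where "B = (\<lambda>S (i::nat, j). if i = j then S else UNIV :: nat set)"
  have finF: "finite F" unfolding F_def by (rule finite_subset[of _ "Pow {1..r}"]) auto
  have "measure_pmf.prob ?p {X. real (max_rainbow n X) < b * real r} \<le>
      measure_pmf.prob ?p (\<Union>S\<in>F. Pi (Knn_edges n) (B S))"
  proof (intro measure_pmf.finite_measure_mono_AE AE_pmfI impI)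
    fix X assume X: "X \<in> set_pmf ?p" and less: "X \<in> {X. real (max_rainbow n X) < b * real r}"
    let ?S = "(\<lambda>i. X (i, i)) ` {1..n}"
    have "?S \<subseteq> {1..r}"
      using X assms(1) by (auto simp: set_colouring_pmf PiE_dflt_def Knn_edges_def)
    moreover have "real (card ?S) < b * real r"
      using max_rainbow_ge_diagonal[of X n] less by simp
    ultimately have "?S \<in> F" by (simp add: F_def)
    moreover have "X \<in> Pi (Knn_edges n) (B ?S)"
      by (auto simp: B_def Knn_edges_def)
    ultimately show "X \<in> (\<Union>S\<in>F. Pi (Knn_edges n) (B S))" by blast
  qed auto
  also have "\<dots> \<le> (\<Sum>S\<in>F. measure_pmf.prob ?p (Pi (Knn_edges n) (B S)))"
    using finF by (intro measure_UNION_le) auto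
  also have "\<dots> \<le> (\<Sum>S\<in>F. b ^ n)"
  proof (intro sum_mono)
    fix S assume S: "S \<in> F"
    have "measure_pmf.prob ?p (Pi (Knn_edges n) (B S)) =
        (\<Prod>e\<in>Knn_edges n. measure_pmf.prob (pmf_of_set {1..r}) (B S e))"
      unfolding colouring_pmf_def by (rule measure_Pi_pmf_Pi) simp
    also have "\<dots> = (\<Prod>(i, j)\<in>Knn_edges n. if i = j then real (card S) / real r else 1)"
      using S assms(1)
      by (intro prod.cong) (auto simp: B_def F_def measure_pmf_of_set Int_absorb1)
    also have "\<dots> = (\<Prod>i\<in>{1..n}. \<Prod>j\<in>{1..n}. if i = j then real (card S) / real r else 1)"
      unfolding Knn_edges_def by (rule prod.cartesian_product[symmetric])
    also have "\<dots> = (real (card S) / real r) ^ n"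
      by simp
    also have "\<dots> \<le> b ^ n"
      using S assms by (intro power_mono) (auto simp: F_def field_simps)
    finally show "measure_pmf.prob ?p (Pi (Knn_edges n) (B S)) \<le> b ^ n" .
  qed
  also have "\<dots> = real (card F) * b ^ n" by simp
  also have "card F \<le> card (Pow {1..r})"
    unfolding F_def by (intro card_mono) auto
  then have "real (card F) * b ^ n \<le> 2 ^ r * b ^ n"
    using assms(2) by (intro mult_right_mono) (auto simp: card_Pow)
  finally show ?thesis .
qed

text \<open>Union bound over planar matchings of size exactly \<open>t\<close>: a larger rainbow
  matching contains a rainbow one of that size.\<close>

lemma prob_max_rainbow_ge:
  assumes "r \<ge> 1"
  shows "measure_pmf.prob (colouring_pmf n r) {X. t \<le> max_rainbow n X} \<le>
    real ((n choose t)\<^sup>2) * (\<Prod>i<t. 1 - real i / real r)"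
proof -
  let ?p = "colouring_pmf n r"
  let ?P = "{M. planar_matching n M \<and> card M = t}"
  have fin: "finite ?P" by (rule finite_subset[OF _ finite_planar_matchings[of n]]) auto
  have prob: "measure_pmf.prob ?p {X. inj_on X M} = (\<Prod>i<t. 1 - real i / real r)"
    if "M \<in> ?P" for M
    using that assms planar_matching_subset_edges[of n M] unfolding colouring_pmf_def
    by (subst prob_inj_on_Pi_pmf) auto
  have "{X. t \<le> max_rainbow n X} \<subseteq> (\<Union>M\<in>?P. {X. inj_on X M})"
  proof
    fix X assume "X \<in> {X. t \<le> max_rainbow n X}"
    moreover obtain M where M: "planar_matching n M" "inj_on X M" "card M = max_rainbow n X"
      by (rule max_rainbow_attained)
    ultimately obtain M' where "M' \<subseteq> M" "card M' = t"
      by (metis mem_Collect_eq obtain_subset_with_card_n)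
    then show "X \<in> (\<Union>M\<in>?P. {X. inj_on X M})"
      using M planar_matching_subset[of n M M'] inj_on_subset[of X M M'] by auto
  qed
  then have "measure_pmf.prob ?p {X. t \<le> max_rainbow n X} \<le>
      measure_pmf.prob ?p (\<Union>M\<in>?P. {X. inj_on X M})"
    by (intro measure_pmf.finite_measure_mono) auto
  also have "\<dots> \<le> (\<Sum>M\<in>?P. measure_pmf.prob ?p {X. inj_on X M})"
    using fin by (intro measure_UNION_le) auto
  also have "\<dots> = real (card ?P) * (\<Prod>i<t. 1 - real i / real r)"
    using prob by simp
  also have "\<dots> \<le> real ((n choose t)\<^sup>2) * (\<Prod>i<t. 1 - real i / real r)"
  proof (intro mult_right_mono of_nat_mono card_planar_matchings_le)
    \<comment> \<open>For \<open>t > r + 1\<close> some factors are negative, so nonnegativity is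
      obtained by reading the product as a probability.\<close>
    have "(\<Prod>i<t. 1 - real i / real r) =
        measure_pmf.prob (Pi_pmf {..<t} 0 (\<lambda>_. pmf_of_set {1..r})) {X. inj_on X {..<t}}"
      using prob_inj_on_Pi_pmf[of "{..<t}" "{..<t}" r 0] assms by simp
    then show "0 \<le> (\<Prod>i<t. 1 - real i / real r)" by simp
  qed
  finally show ?thesis .
qed

text \<open>The single colouring giving every edge colour 1 already has this probability.\<close>

lemma prob_max_rainbow_le_1:
  assumes "r \<ge> 1"
  shows "(1 / real r) ^ n\<^sup>2 \<le> measure_pmf.prob (colouring_pmf n r) {X. max_rainbow n X \<le> 1}"
proof -
  let ?X = "\<lambda>e. if e \<in> Knn_edges n then 1 else 0 :: nat"
  have "(1 / real r) ^ n\<^sup>2 = pmf (colouring_pmf n r) ?X"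
    unfolding colouring_pmf_def using assms by (subst pmf_Pi') (auto simp: card_Knn_edges)
  also have "\<dots> = measure_pmf.prob (colouring_pmf n r) {?X}"
    by (simp add: measure_pmf_single)
  also have "\<dots> \<le> measure_pmf.prob (colouring_pmf n r) {X. max_rainbow n X \<le> 1}"
    by (intro measure_pmf.finite_measure_mono) (use max_rainbow_monochromatic[of n ?X 1] in auto)
  finally show ?thesis .
qed

section \<open>Numerical estimates for the first moment bound\<close>

text \<open>One term of the expansion of \<open>(1 + x) ^ n\<close>. Indexing by
  \<open>n - t\<close> puts the large base \<open>1 / x\<close> under a small exponent when
  \<open>t\<close> is close to \<open>n\<close>.\<close>

lemma choose_le_inverse_power:
  fixes x :: real
  assumes "x > 0" "t \<le> n"
  shows "real (n choose t) \<le> (1 + x) ^ n * (1 / x) ^ (n - t)"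
proof -
  have "real (n choose t) * x ^ (n - t) \<le> (\<Sum>k\<le>n. real (n choose k) * x ^ k * 1 ^ (n - k))"
    using assms member_le_sum[of "n - t" "{..n}" "\<lambda>k. real (n choose k) * x ^ k * 1 ^ (n - k)"]
    by (simp add: binomial_symmetric[of t n])
  also have "\<dots> = (1 + x) ^ n"
    by (simp only: binomial_ring[of x 1 n] add.commute[of 1 x])
  finally show ?thesis using assms(1) by (simp add: field_simps)
qed

lemma prod_one_minus_div_le:
  assumes "t \<le> r"
  shows "(\<Prod>i<t. 1 - real i / real r) \<le> exp (- (real t * (real t - 1) / (2 * real r)))"
proof -
  have "(\<Prod>i<t. 1 - real i / real r) \<le> (\<Prod>i<t. exp (- (real i / real r)))"
  proof (intro prod_mono conjI)
    fix i assume "i \<in> {..<t}"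
    then show "0 \<le> 1 - real i / real r" using assms by (auto simp: field_simps)
    show "1 - real i / real r \<le> exp (- (real i / real r))"
      using exp_ge_add_one_self[of "- (real i / real r)"] by simp
  qed
  also have "\<dots> = exp (- ((\<Sum>i<t. real i) / real r))"
    by (simp add: sum_negf sum_divide_distrib flip: exp_sum)
  also have "(\<Sum>i<t. real i) = real t * (real t - 1) / 2"
    by (induction t) (auto simp: field_simps)
  finally show ?thesis by simp
qed

text \<open>First moment method: for \<open>r\<close> close to \<open>n\<close> and \<open>t\<close> close to \<open>r\<close> there are only
  \<open>exp (0.2 n)\<close> planar matchings of size \<open>t\<close>, while each is rainbow with probability about
  \<open>exp (- 0.48 n)\<close> at most.\<close>

lemma prob_max_rainbow_gt:
  assumes n: "n \<ge> 20" and r: "99 / 100 * real n \<le> real r" "r \<le> n"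
  shows "measure_pmf.prob (colouring_pmf n r) {X. 99 / 100 * real r < real (max_rainbow n X)}
    \<le> exp (- real n / 5) / 2"
proof -
  define t where "t = nat \<lceil>99 / 100 * real r\<rceil>"
  have t: "99 / 100 * real r \<le> real t" "t \<le> r"
    unfolding t_def by linarith+
  \<comment> \<open>\<open>0.99 * 0.99 = 0.9801\<close>, hence at least \<open>0.98\<close>.\<close>
  have tn: "98 / 100 * real n \<le> real t" using t r by linarith
  have r1: "r \<ge> 1" using n r by linarith
  have "(65 / 64 :: real) ^ n \<le> exp (1 / 64) ^ n"
    using exp_ge_add_one_self[of "1 / 64 :: real"] by (intro power_mono) auto
  also have "\<dots> = exp (real n / 64)" by (simp flip: exp_of_nat_mult)
  finally have e1: "(65 / 64 :: real) ^ n \<le> exp (real n / 64)" .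
  have "(64 :: real) = exp (6 * ln 2)" by (simp add: exp_of_nat_mult[of 6, simplified])
  also have "\<dots> \<le> exp (25 / 6)" using ln2_le_25_over_36 by simp
  finally have "(64 :: real) ^ (n - t) \<le> exp (25 / 6) ^ (n - t)"
    by (intro power_mono) auto
  also have "\<dots> = exp (real (n - t) * (25 / 6))" by (simp flip: exp_of_nat_mult)
  \<comment> \<open>\<open>n - t\<close> is at most \<open>n / 50\<close>, and
    \<open>25 / 6 / 50 = 1 / 12\<close>.\<close>
  also have "\<dots> \<le> exp (real n / 12)"
    using tn t(2) r(2) by (simp add: of_nat_diff)
  finally have e2: "(64 :: real) ^ (n - t) \<le> exp (real n / 12)" .
  have "real (n choose t) \<le> (65 / 64) ^ n * 64 ^ (n - t)"
    using choose_le_inverse_power[of "1 / 64" t n] t(2) r(2) by simp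
  also have "\<dots> \<le> exp (real n / 64) * exp (real n / 12)"
    using e1 e2 by (intro mult_mono) auto
  also have "\<dots> = exp (real n / 64 + real n / 12)"
    by (rule exp_add[symmetric])
  finally have "real (n choose t) \<le> exp (real n / 64 + real n / 12)" .
  then have "real (n choose t) ^ 2 \<le> exp (real n / 64 + real n / 12) ^ 2"
    by (intro power_mono) auto
  then have choose: "real ((n choose t)\<^sup>2) \<le> exp (real n / 32 + real n / 6)"
    by (simp flip: exp_double)
  have "98 / 100 * real n * (98 / 100 * real n - 1) / (2 * real n) \<le>
      real t * (real t - 1) / (2 * real r)"
    using n tn r r1 by (intro frac_le mult_mono mult_nonneg_nonneg) auto
  also have "98 / 100 * real n * (98 / 100 * real n - 1) / (2 * real n) =
      4802 / 10000 * real n - 49 / 100"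
    using n by (simp add: field_simps)
  finally have quadratic: "4802 / 10000 * real n - 49 / 100 \<le> real t * (real t - 1) / (2 * real r)" .
  have "measure_pmf.prob (colouring_pmf n r) {X. 99 / 100 * real r < real (max_rainbow n X)} \<le>
      measure_pmf.prob (colouring_pmf n r) {X. t \<le> max_rainbow n X}"
  proof (intro measure_pmf.finite_measure_mono subsetI)
    fix X assume "X \<in> {X. 99 / 100 * real r < real (max_rainbow n X)}"
    then have "99 / 100 * real r < real (max_rainbow n X)" by simp
    then have "t \<le> max_rainbow n X" unfolding t_def by linarith
    then show "X \<in> {X. t \<le> max_rainbow n X}" by simp
  qed simp
  also have "\<dots> \<le> real ((n choose t)\<^sup>2) * (\<Prod>i<t. 1 - real i / real r)"
    using r1 by (rule prob_max_rainbow_ge)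
  also have "\<dots> \<le> exp (real n / 32 + real n / 6) * exp (- (real t * (real t - 1) / (2 * real r)))"
    using choose prod_one_minus_div_le[OF t(2)] t(2)
    by (intro mult_mono prod_nonneg) (auto simp: field_simps)
  also have "\<dots> = exp (real n / 32 + real n / 6 - real t * (real t - 1) / (2 * real r))"
    by (simp flip: exp_add)
  \<comment> \<open>\<open>1 / 32 + 1 / 6 - 0.4802\<close> is below \<open>- 0.28\<close>. The
    surplus \<open>0.08 * n\<close> covers the constant \<open>0.49 + 1\<close> once
    \<open>n \<ge> 20\<close>. The extra \<open>- 1\<close> yields the factor \<open>1 / 2\<close>,
    leaving room for the lower tail.\<close>
  also have "\<dots> \<le> exp (- real n / 5 + (- 1))"
    using quadratic n by simp
  also have "\<dots> = exp (- real n / 5) * inverse (exp 1)"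
    by (simp only: exp_add exp_minus[of 1])
  also have "\<dots> \<le> exp (- real n / 5) / 2"
    using exp_ge_add_one_self[of "1 :: real"] by (simp add: field_simps)
  finally show ?thesis .
qed

section \<open>Combining tail bounds and passing to the mean\<close>

lemma expectation_max_rainbow_ge:
  assumes "r \<ge> 1"
  shows "b * (1 - measure_pmf.prob (colouring_pmf n r) {X. real (max_rainbow n X) < b}) \<le>
    measure_pmf.expectation (colouring_pmf n r) (\<lambda>X. real (max_rainbow n X))"
proof -
  have "b * (1 - measure_pmf.prob (colouring_pmf n r) {X. real (max_rainbow n X) < b}) =
      measure_pmf.expectation (colouring_pmf n r)
        (\<lambda>X. b * (1 - indicator {X. real (max_rainbow n X) < b} X))"
    using assms by simp
  also have "\<dots> \<le> measure_pmf.expectation (colouring_pmf n r) (\<lambda>X. real (max_rainbow n X))"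
    using assms by (intro integral_mono) (auto simp: indicator_def)
  finally show ?thesis .
qed

text \<open>The maximum is at most \<open>b\<close> off the tail event and almost surely at most
  \<open>r\<close> on it.\<close>

lemma expectation_max_rainbow_le:
  assumes "r \<ge> 1"
  shows "measure_pmf.expectation (colouring_pmf n r) (\<lambda>X. real (max_rainbow n X)) \<le>
    b + (real r - b) * measure_pmf.prob (colouring_pmf n r) {X. b < real (max_rainbow n X)}"
proof -
  have "measure_pmf.expectation (colouring_pmf n r) (\<lambda>X. real (max_rainbow n X)) \<le>
      measure_pmf.expectation (colouring_pmf n r)
        (\<lambda>X. b + (real r - b) * indicator {X. b < real (max_rainbow n X)} X)"
    using assms
    by (intro integral_mono_AE AE_pmfI)
       (auto simp: indicator_def dest!: max_rainbow_le_colouring_pmf[rotated])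
  also have "\<dots> = b + (real r - b) *
      measure_pmf.prob (colouring_pmf n r) {X. b < real (max_rainbow n X)}"
    using assms by simp
  finally show ?thesis .
qed

lemma prob_max_rainbow_between:
  "1 - measure_pmf.prob p {X. real (max_rainbow n X) < a}
     - measure_pmf.prob p {X. b < real (max_rainbow n X)}
   \<le> measure_pmf.prob p {X. a \<le> real (max_rainbow n X) \<and> real (max_rainbow n X) \<le> b}"
proof -
  let ?A = "{X. real (max_rainbow n X) < a}" and ?B = "{X. b < real (max_rainbow n X)}"
  have "{X. a \<le> real (max_rainbow n X) \<and> real (max_rainbow n X) \<le> b} = UNIV - (?A \<union> ?B)"
    by auto
  then show ?thesis
    using measure_pmf.prob_compl[of "?A \<union> ?B" p] measure_Un_le[of ?A "measure_pmf p" ?B] by simp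
qed

text \<open>Since \<open>r\<close> is \<alpha> times \<open>n\<close>, the palette bound
  \<open>2 ^ r * b ^ n\<close> is geometric in \<open>n\<close>.\<close>

lemma max_rainbow_lower_tail:
  assumes "r \<ge> 1" "real r = \<alpha> * real n" "b \<ge> 0" "2 powr \<alpha> * b \<le> 1 / 3"
  shows "measure_pmf.prob (colouring_pmf n r) {X. real (max_rainbow n X) < b * real r}
    \<le> (1 / 3) ^ n"
proof -
  have "(2::real) ^ r * b ^ n = (2 powr \<alpha> * b) ^ n"
    using assms(2) by (simp add: power_mult_distrib powr_realpow powr_powr flip: powr_realpow)
  also have "\<dots> \<le> (1 / 3) ^ n" using assms(3,4) by (intro power_mono) auto
  finally show ?thesis
    using prob_max_rainbow_less[OF assms(1,3), of n] by linarith
qed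

lemma power_third_le_exp: "(1 / 3 :: real) ^ n \<le> exp (- real n)"
proof -
  have "(1 / 3 :: real) \<le> exp (- 1)"
    using exp_le by (simp add: exp_minus field_simps)
  then have "(1 / 3 :: real) ^ n \<le> exp (- 1) ^ n" by (intro power_mono) auto
  then show ?thesis by (simp flip: exp_of_nat_mult)
qed

text \<open>Here \<open>r \<ge> 2\<close>, so a maximum of 1 lies below \<open>0.99 * r\<close>. The
  bounds \<open>r < 20\<close> and \<open>n * n \<le> 400\<close> make the probability of a
  monochromatic colouring uniformly positive.\<close>

lemma max_rainbow_upper_tail_small:
  assumes "1 \<le> n" "n < 20" "99 / 100 * real n < real r" "r \<le> n" "\<not> (n = 1 \<and> r = 1)"
  shows "measure_pmf.prob (colouring_pmf n r) {X. 99 / 100 * real r < real (max_rainbow n X)}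
    \<le> 1 - (1 / 20) ^ 400"
proof -
  have "n \<noteq> 1" using assms by (cases "r = 0") auto
  then have r2: "2 \<le> r" using assms by linarith
  have "n\<^sup>2 \<le> 20\<^sup>2" using assms(2) by (intro power_mono) auto
  then have "(1 / 20 :: real) ^ 400 \<le> (1 / 20) ^ n\<^sup>2"
    by (intro power_decreasing) auto
  also have "\<dots> \<le> (1 / real r) ^ n\<^sup>2"
    using assms r2 by (intro power_mono) (auto simp: field_simps)
  also have "\<dots> \<le> measure_pmf.prob (colouring_pmf n r) {X. max_rainbow n X \<le> 1}"
    using r2 by (intro prob_max_rainbow_le_1) auto
  also have "\<dots> \<le> measure_pmf.prob (colouring_pmf n r)
      (UNIV - {X. 99 / 100 * real r < real (max_rainbow n X)})"
    using r2 by (intro measure_pmf.finite_measure_mono) auto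
  also have "\<dots> = 1 - measure_pmf.prob (colouring_pmf n r)
      {X. 99 / 100 * real r < real (max_rainbow n X)}"
    using measure_pmf.prob_compl by fastforce
  finally show ?thesis by linarith
qed

theorem theorem2p2:
  shows "(\<exists>\<alpha>0::real. 0 < \<alpha>0 \<and> \<alpha>0 < 1 \<and>
           (\<forall>\<alpha>::real. \<alpha> > \<alpha>0 \<longrightarrow>
             (\<exists>\<beta>1 \<beta>2 \<beta>3 :: real. 0 < \<beta>1 \<and> \<beta>1 \<le> \<beta>2 \<and> \<beta>2 < 1 \<and> \<beta>3 > 0 \<and>
               (\<forall>n r :: nat. n \<ge> 1 \<and> real r = \<alpha> * real n \<and> \<not> (n = 1 \<and> r = 1) \<longrightarrow>
                  measure_pmf.prob (colouring_pmf n r)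
                    {X. \<beta>1 * real r \<le> real (max_rainbow n X) \<and>
                        real (max_rainbow n X) \<le> \<beta>2 * real r}
                    \<ge> 1 - exp (- \<beta>3 * real n) \<and>
                  \<beta>1 * real r \<le> measure_pmf.expectation (colouring_pmf n r)
                                  (\<lambda>X. real (max_rainbow n X)) \<and>
                  measure_pmf.expectation (colouring_pmf n r)
                                  (\<lambda>X. real (max_rainbow n X)) \<le> \<beta>2 * real r)))) \<and>
         (\<forall>(\<alpha>::real) (n::nat) (r::nat). \<alpha> > 0 \<and> n \<ge> 1 \<and> real r = \<alpha> * real n \<longrightarrow>
            measure_pmf.variance (colouring_pmf n r) (\<lambda>X. real (max_rainbow n X))
              \<le> 2 * measure_pmf.expectation (colouring_pmf n r) (\<lambda>X. real (max_rainbow n X)))"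
proof (rule conjI; (rule exI[of _ "99 / 100"])?; intro conjI allI impI)
  fix \<alpha> :: real assume \<alpha>: "99 / 100 < \<alpha>"
  \<comment> \<open>The first bound lets the lower tail estimate apply to both \<open>b\<close> and
    \<open>2 * b\<close>; the second gives \<open>b * r \<le> 1\<close> when
    \<open>r \<le> n < 20\<close>.\<close>
  define b where "b = min (2 powr (- \<alpha>) / 6) (1 / 20)"
  have b: "0 < b" "b \<le> 1 / 20" by (auto simp: b_def)
  have "b \<le> 2 powr (- \<alpha>) / 6" by (simp add: b_def)
  then have "2 powr \<alpha> * b \<le> 2 powr \<alpha> * (2 powr (- \<alpha>) / 6)"
    by (intro mult_left_mono) auto
  also have "\<dots> = 1 / 6" by (simp add: powr_minus)
  finally have b2: "2 powr \<alpha> * (2 * b) \<le> 1 / 3" by simp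
  have lower_tail: "measure_pmf.prob (colouring_pmf n r) {X. real (max_rainbow n X) < b * real r}
      \<le> (1 / 3) ^ n"
    if "r \<ge> 1" "real r = \<alpha> * real n" for n r
    using that b b2 by (intro max_rainbow_lower_tail[of r \<alpha>]) auto
  have lower_mean: "b * real r \<le>
      measure_pmf.expectation (colouring_pmf n r) (\<lambda>X. real (max_rainbow n X))"
    if "n \<ge> 1" "r \<ge> 1" "real r = \<alpha> * real n" for n r
  proof -
    \<comment> \<open>With probability at least \<open>1 / 2\<close> the maximum reaches
      \<open>2 * b * r\<close>, so its mean is at least \<open>b * r\<close>.\<close>
    have "(1 / 3 :: real) ^ n \<le> (1 / 3) ^ 1" using that by (intro power_decreasing) auto
    then have "measure_pmf.prob (colouring_pmf n r) {X. real (max_rainbow n X) < 2 * b * real r}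
        \<le> 1 / 2"
      using max_rainbow_lower_tail[of r \<alpha> n "2 * b"] that b b2 by simp
    then have "2 * b * real r * (1 / 2) \<le> 2 * b * real r * (1 - measure_pmf.prob (colouring_pmf n r)
        {X. real (max_rainbow n X) < 2 * b * real r})"
      using b by (intro mult_left_mono) auto
    then show ?thesis
      using expectation_max_rainbow_ge[of r "2 * b * real r" n] that by linarith
  qed
  show "\<exists>\<beta>1 \<beta>2 \<beta>3 :: real. 0 < \<beta>1 \<and> \<beta>1 \<le> \<beta>2 \<and> \<beta>2 < 1 \<and> \<beta>3 > 0 \<and>
      (\<forall>n r :: nat. n \<ge> 1 \<and> real r = \<alpha> * real n \<and> \<not> (n = 1 \<and> r = 1) \<longrightarrow>
        measure_pmf.prob (colouring_pmf n r)
          {X. \<beta>1 * real r \<le> real (max_rainbow n X) \<and> real (max_rainbow n X) \<le> \<beta>2 * real r}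
          \<ge> 1 - exp (- \<beta>3 * real n) \<and>
        \<beta>1 * real r \<le> measure_pmf.expectation (colouring_pmf n r) (\<lambda>X. real (max_rainbow n X)) \<and>
        measure_pmf.expectation (colouring_pmf n r) (\<lambda>X. real (max_rainbow n X)) \<le> \<beta>2 * real r)"
  proof (cases "\<alpha> > 1")
    case True
    \<comment> \<open>\<open>1 / \<alpha>\<close> comes from the trivial bound by \<open>n\<close>;
      the maximum with \<open>b\<close> ensures that the two constants are ordered.\<close>
    define c where "c = max b (1 / \<alpha>)"
    have c: "b \<le> c" "c < 1" using True b by (auto simp: c_def)
    show ?thesis
    proof (rule exI[of _ b], rule exI[of _ c], rule exI[of _ 1],
        intro conjI allI impI; (elim conjE)?)
      fix n r :: nat assume n: "1 \<le> n" and r: "real r = \<alpha> * real n"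
      have "real r > 0" using n r \<alpha> by simp
      then have r1: "r \<ge> 1" by simp
      have "1 / \<alpha> * real r \<le> c * real r" by (intro mult_right_mono) (auto simp: c_def)
      then have le: "real (max_rainbow n X) \<le> c * real r" for X
        using max_rainbow_le[of n X] r True by simp
      then have "{X. c * real r < real (max_rainbow n X)} = {}"
        by (simp add: not_less)
      then show "1 - exp (- 1 * real n) \<le> measure_pmf.prob (colouring_pmf n r)
          {X. b * real r \<le> real (max_rainbow n X) \<and> real (max_rainbow n X) \<le> c * real r}"
        using prob_max_rainbow_between[of "colouring_pmf n r" n "b * real r" "c * real r"]
          lower_tail[OF r1 r] power_third_le_exp[of n] by simp
      show "b * real r \<le> measure_pmf.expectation (colouring_pmf n r) (\<lambda>X. real (max_rainbow n X))"
        using n r1 r by (rule lower_mean)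
      show "measure_pmf.expectation (colouring_pmf n r) (\<lambda>X. real (max_rainbow n X)) \<le> c * real r"
        using measure_pmf.integral_le_const[of "colouring_pmf n r" "\<lambda>X. real (max_rainbow n X)"]
          r1 le by simp
    qed (use b c in auto)
  next
    case False
    define \<delta> :: real where "\<delta> = (1 / 20) ^ 400"
    have \<delta>: "0 < \<delta>" "\<delta> \<le> 1 / 20"
      using power_decreasing[of 1 400 "1 / 20 :: real"] by (simp_all add: \<delta>_def)
    show ?thesis
    \<comment> \<open>The mean is at most \<open>0.99 * r + 0.01 * r * (1 - \<delta>)\<close>, which
      is \<open>(1 - \<delta> / 100) * r\<close>. The rate \<open>\<delta> / 20\<close> makes
      \<open>exp (- (\<delta> / 20) * n)\<close> at least \<open>1 - \<delta>\<close> for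
      \<open>n < 20\<close>, and is below the rate \<open>1 / 5\<close> used for larger
      \<open>n\<close>.\<close>
    proof (rule exI[of _ b], rule exI[of _ "1 - \<delta> / 100"], rule exI[of _ "\<delta> / 20"],
        intro conjI allI impI; (elim conjE)?)
      fix n r :: nat
      assume n: "1 \<le> n" and r: "real r = \<alpha> * real n" and excl: "\<not> (n = 1 \<and> r = 1)"
      let ?p = "colouring_pmf n r"
      let ?U = "measure_pmf.prob ?p {X. 99 / 100 * real r < real (max_rainbow n X)}"
      have "real r > 0" using n r \<alpha> by simp
      then have r1: "r \<ge> 1" by simp
      have r99: "99 / 100 * real n < real r" using n r \<alpha> by simp
      have "real r \<le> real n" using False n r by (simp add: mult_left_le_one_le)
      then have rn: "r \<le> n" by simp
      have tails: "measure_pmf.prob ?p {X. real (max_rainbow n X) < b * real r} + ?U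
          \<le> exp (- (\<delta> / 20) * real n)" and upper: "?U \<le> 1 - \<delta>"
      proof -
        consider "n < 20" | "n \<ge> 20" by linarith
        then have "measure_pmf.prob ?p {X. real (max_rainbow n X) < b * real r} + ?U
          \<le> exp (- (\<delta> / 20) * real n) \<and> ?U \<le> 1 - \<delta>"
        proof cases
          case 1
          \<comment> \<open>For small \<open>n\<close> the lower tail event is empty, since
            \<open>b * r \<le> 1\<close> and the maximum is at least 1.\<close>
          have "b * real r \<le> real (max_rainbow n X)" for X
          proof -
            have "b * real r \<le> 1 / 20 * 20" using b rn 1 by (intro mult_mono) auto
            then show ?thesis using max_rainbow_pos[OF n, of X] by simp
          qed
          then have "{X. real (max_rainbow n X) < b * real r} = {}" by (simp add: not_less)
          moreover have U: "?U \<le> 1 - \<delta>"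
            unfolding \<delta>_def using n 1 r99 rn excl by (rule max_rainbow_upper_tail_small)
          moreover have "1 - \<delta> \<le> exp (- (\<delta> / 20) * real n)"
          proof -
            have "\<delta> * real n \<le> \<delta> * 20" using 1 \<delta> by (intro mult_left_mono) auto
            then show ?thesis using exp_ge_add_one_self[of "- (\<delta> / 20) * real n"] by simp
          qed
          ultimately show ?thesis by simp
        next
          case 2
          have half: "exp (- y) \<le> (1 / 2 :: real)" if "y \<ge> 1" for y
          proof -
            have "2 \<le> exp y" using exp_ge_add_one_self[of y] that by linarith
            then show ?thesis by (simp add: exp_minus field_simps)
          qed
          have U: "?U \<le> exp (- real n / 5) / 2"
            using 2 r99 rn by (intro prob_max_rainbow_gt) auto
          \<comment> \<open>Each tail gets half of \<open>exp (- n / 5)\<close>; the lower one has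
            the spare factor \<open>exp (- 4 * n / 5)\<close>.\<close>
          have "exp (- real n) = exp (- real n / 5) * exp (- (4 * real n / 5))"
            by (simp flip: exp_add)
          also have "\<dots> \<le> exp (- real n / 5) * (1 / 2)"
            using 2 by (intro mult_left_mono half) auto
          finally have L: "measure_pmf.prob ?p {X. real (max_rainbow n X) < b * real r}
              \<le> exp (- real n / 5) / 2"
            using lower_tail[OF r1 r] power_third_le_exp[of n] by simp
          have "\<delta> / 20 * real n \<le> 1 / 5 * real n" using \<delta> by (intro mult_right_mono) auto
          then have "exp (- real n / 5) \<le> exp (- (\<delta> / 20) * real n)" by simp
          moreover have "exp (- real n / 5) \<le> 1 / 2" using half[of "real n / 5"] 2 by simp
          ultimately show ?thesis using U L \<delta> by linarith
        qed
        then show "measure_pmf.prob ?p {X. real (max_rainbow n X) < b * real r} + ?U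
          \<le> exp (- (\<delta> / 20) * real n)" "?U \<le> 1 - \<delta>" by blast+
      qed
      have "99 / 100 * real r \<le> (1 - \<delta> / 100) * real r"
        using \<delta> by (intro mult_right_mono) auto
      then have "measure_pmf.prob ?p {X. (1 - \<delta> / 100) * real r < real (max_rainbow n X)} \<le> ?U"
        by (intro measure_pmf.finite_measure_mono) auto
      then show "1 - exp (- (\<delta> / 20) * real n) \<le> measure_pmf.prob ?p
          {X. b * real r \<le> real (max_rainbow n X) \<and>
            real (max_rainbow n X) \<le> (1 - \<delta> / 100) * real r}"
        using prob_max_rainbow_between[of ?p n "b * real r" "(1 - \<delta> / 100) * real r"] tails
        by linarith
      show "b * real r \<le> measure_pmf.expectation ?p (\<lambda>X. real (max_rainbow n X))"
        using n r1 r by (rule lower_mean)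
      have "(real r - 99 / 100 * real r) * ?U \<le> (real r - 99 / 100 * real r) * (1 - \<delta>)"
        using upper by (intro mult_left_mono) auto
      then show "measure_pmf.expectation ?p (\<lambda>X. real (max_rainbow n X))
          \<le> (1 - \<delta> / 100) * real r"
        using expectation_max_rainbow_le[OF r1, of n "99 / 100 * real r"]
        by (simp add: algebra_simps)
    qed (use b \<delta> in auto)
  qed
next
  fix \<alpha> :: real and n r :: nat
  assume "0 < \<alpha> \<and> 1 \<le> n \<and> real r = \<alpha> * real n"
  then have "real r > 0" by simp
  then have r1: "r \<ge> 1" by simp
  have "0 \<le> measure_pmf.expectation (colouring_pmf n r) (\<lambda>X. real (max_rainbow n X))"
    by simp
  then show "measure_pmf.variance (colouring_pmf n r) (\<lambda>X. real (max_rainbow n X))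
      \<le> 2 * measure_pmf.expectation (colouring_pmf n r) (\<lambda>X. real (max_rainbow n X))"
    using variance_max_rainbow_le[OF r1, of n] by linarith
qed auto

end
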